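(* Let $\mathbf A = \langle A, \to, 0\rangle$ be an implication zroupoid. Then the algebra $\mathbf A_{mj} = \langle A, \wedge, \vee\rangle$ is a Birkhoff system if and only if $\mathbf A \in \mathcal S$, i.e. if and only if $\mathbf A$ is symmetric.
   Context: An implication zroupoid is an algebra $\mathbf A = \langle A, \to, 0\rangle$, where $\to$ is a binary operation and $0$ is a constant, such that, writing $x' := x \to 0$ (and $x'' := (x')'$), the following hold for all $x,y,z\in A$: (1) $(x \to y) \to z = [(z' \to x) \to (y \to z)']'$, and (2) $0'' = 0$. For an implication zroupoid $\mathbf A$, define on $A$ the operations $x \wedge y := (x \to y')'$ and $x \vee y := (x' \wedge y')'$, and put $\mathbf A_{mj} := \langle A, \wedge, \vee\rangle$. An implication zroupoid $\mathbf A$ is symmetric if it is both involutive ($x'' = x$ for all $x\in A$) and meet-commutative ($x \wedge y = y \wedge x$ for all $x,y\in A$). $\mathcal S$ denotes the variety of symmetric implication zroupoids. A bisemilattice is an algebra $\langle B, \wedge, \vee\rangle$ in which both binary operations $\wedge$ and $\vee$ are associative, commutative and idempotent. A Birkhoff system is a bisemilattice satisfying the Birkhoff identity $x \wedge (x \vee y) = x \vee (x \wedge y)$ for all $x,y$. *)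

theory Defs
  imports Main
begin

text \<open>
  An algebra is represented by its operations on a type, which is its (nonempty) carrier.
\<close>

locale zroupoid =
  fixes imp :: "'a \<Rightarrow> 'a \<Rightarrow> 'a"  (infixr \<open>\<rightarrow>\<close> 60)
    and zero :: 'a  (\<open>\<zero>\<close>)
begin

definition neg :: "'a \<Rightarrow> 'a"  (\<open>\<sim> _\<close> [80] 80)
  where "\<sim> x = x \<rightarrow> \<zero>"

definition meet :: "'a \<Rightarrow> 'a \<Rightarrow> 'a"  (infixl \<open>\<sqinter>\<close> 70)
  where "x \<sqinter> y = \<sim> (x \<rightarrow> \<sim> y)"

definition join :: "'a \<Rightarrow> 'a \<Rightarrow> 'a"  (infixl \<open>\<squnion>\<close> 65)
  where "x \<squnion> y = \<sim> (\<sim> x \<sqinter> \<sim> y)"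

end

locale implication_zroupoid = zroupoid +
  assumes imp_imp: "(x \<rightarrow> y) \<rightarrow> z = \<sim> ((\<sim> z \<rightarrow> x) \<rightarrow> \<sim> (y \<rightarrow> z))"
    and neg_neg_zero: "\<sim> (\<sim> \<zero>) = \<zero>"

locale symmetric_implication_zroupoid = implication_zroupoid +
  assumes involutive: "\<sim> (\<sim> x) = x"
    and meet_commute: "x \<sqinter> y = y \<sqinter> x"

text \<open>
  The library locale \<^locale>\<open>semilattice\<close> requires exactly associativity, commutativity and
  idempotence. The two semilattice operations need not induce the same order.
\<close>

locale bisemilattice =
  meet: semilattice meet + join: semilattice join
  for meet :: "'a \<Rightarrow> 'a \<Rightarrow> 'a"  (infixl \<open>\<sqinter>\<close> 70)
    and join :: "'a \<Rightarrow> 'a \<Rightarrow> 'a"  (infixl \<open>\<squnion>\<close> 65)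

locale birkhoff_system = bisemilattice +
  assumes birkhoff: "x \<sqinter> (x \<squnion> y) = x \<squnion> (x \<sqinter> y)"

end

theory Submission
  imports Defs
begin

text \<open>
  Rewriting \<open>x \<rightarrow> y\<close> as \<open>\<sim> (x \<sqinter> \<sim> y)\<close> turns the defining identity of a symmetric
  implication zroupoid into distributivity of meet over its De Morgan dual join. Hence both
  operations are commutative, distribute over each other, and have units \<open>\<sim> \<zero>\<close> and
  \<open>\<zero>\<close>. Idempotence follows from this, and the Birkhoff identity is an instance of
  distributivity. For associativity, write \<open>A = (x \<sqinter> y) \<sqinter> z\<close> and
  \<open>B = x \<sqinter> (y \<sqinter> z)\<close>. As in Huntington's treatment of Boolean algebras, it
  suffices that each of \<open>x\<close>, \<open>y\<close>, \<open>z\<close> has the same join with \<open>A\<close> as with \<open>B\<close>; in the absence of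
  absorption this reduces to the case in which one factor is \<open>\<zero>\<close>.
\<close>

locale doubly_distributive =
  fixes meet :: "'a \<Rightarrow> 'a \<Rightarrow> 'a"  (infixl \<open>\<sqinter>\<close> 70)
    and join :: "'a \<Rightarrow> 'a \<Rightarrow> 'a"  (infixl \<open>\<squnion>\<close> 65)
    and top :: 'a  (\<open>\<one>\<close>)
    and bot :: 'a  (\<open>\<zero>\<close>)
  assumes meet_comm: "x \<sqinter> y = y \<sqinter> x"
    and join_comm: "x \<squnion> y = y \<squnion> x"
    and meet_distrib: "x \<sqinter> (y \<squnion> z) = x \<sqinter> y \<squnion> x \<sqinter> z"
    and join_distrib: "x \<squnion> y \<sqinter> z = (x \<squnion> y) \<sqinter> (x \<squnion> z)"
    and meet_top: "x \<sqinter> \<one> = x"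
    and join_bot: "x \<squnion> \<zero> = x"
begin

text \<open>The axioms are self-dual, so \<open>[OF dual]\<close> turns each later fact into its
  mirror image.\<close>

lemma dual: "doubly_distributive join meet bot top"
  by unfold_locales (rule join_comm meet_comm join_distrib meet_distrib join_bot meet_top)+

lemma bot_meet_bot: "\<zero> \<sqinter> \<zero> = \<zero>"
  by (metis join_bot join_comm meet_distrib meet_top)

lemma join_idem: "x \<squnion> x = x"
  by (metis doubly_distributive.bot_meet_bot[OF dual] meet_distrib meet_top)

lemma meet_join_self: "x \<sqinter> (x \<squnion> y) = x \<squnion> x \<sqinter> y"
  by (metis join_distrib join_idem)

lemma join_meet_top: "x \<squnion> x \<sqinter> y = x \<sqinter> (\<one> \<squnion> y)"
  by (metis meet_distrib meet_top)

text \<open>Together with \<open>join_meet_top\<close> this replaces absorption: under a join with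
  x, a factor x of a meet may be traded for \<zero>.\<close>

lemma join_meet_bot: "x \<squnion> \<zero> \<sqinter> y = x \<sqinter> (\<one> \<squnion> y)"
  by (metis join_distrib join_bot meet_join_self join_meet_top)

lemma meet_bot_top: "\<zero> \<sqinter> (\<one> \<squnion> x) = \<zero> \<sqinter> x"
  by (metis join_bot join_comm join_meet_bot)

text \<open>By \<open>join_meet_bot\<close> the left side is the join of x \<sqinter> y and \<zero>
  \<sqinter> x; factoring out x leaves x \<sqinter> (y \<squnion> \<zero>).\<close>

lemma top_meet_absorb: "(\<one> \<squnion> x) \<sqinter> (x \<sqinter> y) = x \<sqinter> y"
  by (metis join_bot join_comm join_meet_bot meet_comm meet_distrib)

lemma bot_meet_meet: "(\<zero> \<sqinter> x) \<sqinter> y = \<zero> \<sqinter> x \<squnion> \<zero> \<sqinter> y"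
proof -
  let ?u = "\<zero> \<sqinter> x"
  have "?u \<sqinter> y = (\<one> \<squnion> ?u) \<sqinter> (?u \<sqinter> y)"
    by (simp only: top_meet_absorb)
  \<comment> \<open>The dual of \<open>meet_bot_top\<close> shrinks \<one> \<squnion> ?u to \<one>
    \<squnion> x, the form that \<open>join_meet_bot\<close> needs.\<close>
  also have "\<dots> = (?u \<sqinter> y) \<sqinter> (\<one> \<squnion> x)"
    by (simp only: doubly_distributive.meet_bot_top[OF dual] meet_comm)
  also have "\<dots> = ?u \<sqinter> y \<squnion> ?u"
    by (simp only: join_meet_bot)
  also have "\<dots> = ?u \<sqinter> (\<one> \<squnion> y)"
    by (simp only: join_meet_top join_comm[of "?u \<sqinter> y"])
  finally show ?thesis
    by (simp only: join_meet_bot)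
qed

text \<open>Once \<one> is joined to x \<sqinter> y, the dual of \<open>bot_meet_meet\<close> turns
  the meet into a join, over which \<zero> distributes.\<close>

lemma bot_assoc: "(\<zero> \<sqinter> x) \<sqinter> y = \<zero> \<sqinter> (x \<sqinter> y)"
proof -
  have "\<zero> \<sqinter> (x \<sqinter> y) = \<zero> \<sqinter> (\<one> \<squnion> x \<sqinter> y)"
    by (simp only: meet_bot_top)
  also have "\<dots> = \<zero> \<sqinter> ((\<one> \<squnion> x) \<squnion> y)"
    by (simp only: doubly_distributive.bot_meet_meet[OF dual] join_distrib)
  also have "\<dots> = \<zero> \<sqinter> x \<squnion> \<zero> \<sqinter> y"
    by (simp only: meet_distrib[of _ "\<one> \<squnion> x"] meet_bot_top)
  finally show ?thesis
    by (simp only: bot_meet_meet)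
qed

text \<open>The join with x turns the factor x into \<zero>, where \<open>bot_assoc\<close>
  applies.\<close>

lemma join_assoc_left: "x \<squnion> (x \<sqinter> y) \<sqinter> z = x \<squnion> x \<sqinter> (y \<sqinter> z)"
proof -
  have "x \<squnion> (x \<sqinter> y) \<sqinter> z = (x \<squnion> \<zero> \<sqinter> y) \<sqinter> (x \<squnion> z)"
    by (simp add: join_distrib[of x "x \<sqinter> y"] join_meet_top join_meet_bot)
  also have "\<dots> = x \<squnion> \<zero> \<sqinter> (y \<sqinter> z)"
    by (metis join_distrib bot_assoc)
  finally show ?thesis
    by (simp add: join_meet_top join_meet_bot)
qed

lemma join_assoc_middle: "y \<squnion> (x \<sqinter> y) \<sqinter> z = y \<squnion> x \<sqinter> (y \<sqinter> z)"
proof -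
  have "y \<squnion> (x \<sqinter> y) \<sqinter> z = (y \<squnion> \<zero> \<sqinter> x) \<sqinter> (y \<squnion> z)"
    by (metis join_distrib meet_comm join_meet_top join_meet_bot)
  also have "\<dots> = y \<squnion> (\<zero> \<sqinter> x) \<sqinter> z"
    by (simp add: join_distrib)
  \<comment> \<open>Next to a factor \<zero> the other two factors may be swapped; trading \<zero>
    back for y then pairs y with z.\<close>
  also have "\<dots> = y \<squnion> (\<zero> \<sqinter> z) \<sqinter> x"
    by (metis bot_assoc meet_comm)
  also have "\<dots> = (y \<squnion> y \<sqinter> z) \<sqinter> (y \<squnion> x)"
    by (metis join_distrib join_meet_bot join_meet_top)
  finally show ?thesis
    by (metis join_distrib meet_comm)
qed

lemma join_assoc_right: "z \<squnion> (x \<sqinter> y) \<sqinter> z = z \<squnion> x \<sqinter> (y \<sqinter> z)"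
  using join_assoc_left[of z y x] by (metis meet_comm)

lemma meet_assoc: "(x \<sqinter> y) \<sqinter> z = x \<sqinter> (y \<sqinter> z)" (is "?A = ?B")
proof -
  have eqs: "?A \<squnion> x = ?B \<squnion> x" "?A \<squnion> y = ?B \<squnion> y" "?A \<squnion> z = ?B \<squnion> z"
    using join_assoc_left join_assoc_middle join_assoc_right by (simp_all only: join_comm)
  \<comment> \<open>Expand the second copy in ?A \<squnion> ?A. The three factors do not tell ?A
    from ?B by \<open>eqs\<close>; the bracketing alone decides which of the two is the second
    operand.\<close>
  have "?A = ((?A \<squnion> x) \<sqinter> (?A \<squnion> y)) \<sqinter> (?A \<squnion> z)"
    by (simp only: join_idem flip: join_distrib)
  also have "\<dots> = ?B \<squnion> ?A"
    by (simp only: eqs join_distrib)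
  also have "\<dots> = ?A \<squnion> ?B"
    by (rule join_comm)
  also have "\<dots> = (?B \<squnion> x) \<sqinter> ((?B \<squnion> y) \<sqinter> (?B \<squnion> z))"
    by (simp only: join_distrib flip: eqs)
  also have "\<dots> = ?B"
    by (simp only: join_idem flip: join_distrib)
  finally show ?thesis .
qed

sublocale birkhoff_system meet join
  by unfold_locales
    (rule meet_assoc meet_comm doubly_distributive.join_idem[OF dual] doubly_distributive.meet_assoc[OF dual] join_comm join_idem meet_join_self)+

end

context symmetric_implication_zroupoid
begin

lemma neg_meet: "\<sim> (x \<sqinter> y) = \<sim> x \<squnion> \<sim> y"
  by (simp add: join_def involutive)

lemma meet_neg_zero: "x \<sqinter> \<sim> \<zero> = x"
  by (simp add: meet_def neg_neg_zero involutive flip: neg_def)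

lemma imp_eq_neg_meet: "x \<rightarrow> y = \<sim> (x \<sqinter> \<sim> y)"
  by (simp add: meet_def involutive)

lemma meet_join_distrib: "x \<sqinter> (y \<squnion> z) = x \<sqinter> y \<squnion> x \<sqinter> z"
proof -
  have "\<sim> ((y \<squnion> z) \<sqinter> x) = \<sim> (x \<sqinter> y) \<sqinter> \<sim> (z \<sqinter> x)"
    \<comment> \<open>With these negations, \<sim> y \<rightarrow> z is y \<squnion> z, and the
      implications between x and y and between z and x become negated meets.\<close>
    using imp_imp[of "\<sim> y" z "\<sim> x"] by (simp add: imp_eq_neg_meet involutive join_def)
  then show ?thesis
    by (metis involutive join_def meet_commute)
qed

sublocale doubly_distributive meet join "\<sim> \<zero>" \<zero>
proof
  show "x \<sqinter> y = y \<sqinter> x" for x y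
    by (rule meet_commute)
  show "x \<squnion> y = y \<squnion> x" for x y
    by (metis join_def meet_commute)
  show "x \<sqinter> (y \<squnion> z) = x \<sqinter> y \<squnion> x \<sqinter> z" for x y z
    by (rule meet_join_distrib)
  show "x \<squnion> y \<sqinter> z = (x \<squnion> y) \<sqinter> (x \<squnion> z)" for x y z
    by (metis meet_join_distrib neg_meet join_def involutive)
  show "x \<sqinter> \<sim> \<zero> = x" for x
    by (rule meet_neg_zero)
  show "x \<squnion> \<zero> = x" for x
    by (simp add: join_def meet_neg_zero involutive)
qed

end

theorem corollary4p3:
  fixes imp :: "'a \<Rightarrow> 'a \<Rightarrow> 'a" and zero :: 'a
  assumes "implication_zroupoid imp zero"
  shows "birkhoff_system (zroupoid.meet imp zero) (zroupoid.join imp zero)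
    \<longleftrightarrow> symmetric_implication_zroupoid imp zero"
proof
  interpret implication_zroupoid imp zero by (rule assms)
  assume "birkhoff_system meet join"
  then interpret B: birkhoff_system meet join .
  show "symmetric_implication_zroupoid imp zero"
  proof
    show "x \<sqinter> y = y \<sqinter> x" for x y
      by (rule B.meet.commute)
    \<comment> \<open>Idempotence of meet collapses x \<squnion> x, by definition \<sim> (\<sim> x
      \<sqinter> \<sim> x), to the double negation.\<close>
    show "\<sim> (\<sim> x) = x" for x
      by (metis B.join.idem B.meet.idem join_def)
  qed
next
  assume "symmetric_implication_zroupoid imp zero"
  then interpret symmetric_implication_zroupoid imp zero .
  show "birkhoff_system meet join" ..
qed

end
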